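(* Let $G$ be an infinite finitely generated torsion group and let $S$ be a finite generating set of $G$. Then the Cayley graph $\Gamma(G,S)$ does not admit a graph height function.
   Context: A torsion group is a group all of whose elements have finite order. All generating sets are finite, symmetric ($S=S^{-1}$) and do not contain the identity. The Cayley graph $\Gamma(G,S)$ has vertex set $G$ and an edge between $g$ and $gs$ for all $g\in G$, $s\in S$. For a graph $\Gamma$ with vertex set $V_\Gamma$, $\mathrm{Aut}(\Gamma)$ is the group of bijections of $V_\Gamma$ preserving adjacency; a subgroup $H\le\mathrm{Aut}(\Gamma)$ acts quasi-transitively if it has finitely many orbits on $V_\Gamma$. A graph height function on an infinite, connected, locally finite, quasi-transitive graph $\Gamma$ is a pair $(h,H)$ consisting of a function $h:V_\Gamma\to\mathbb{Z}$ and a subgroup $H\le\mathrm{Aut}(\Gamma)$ acting quasi-transitively on $\Gamma$ such that: (i) for all $u,v\in V_\Gamma$ and $g\in H$, $h(g\cdot v)-h(g\cdot u)=h(v)-h(u)$; (ii) for all $u\in V_\Gamma$ there exist $v,v'\in V_\Gamma$ adjacent to $u$ with $h(v)<h(u)<h(v')$. *)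

theory Defs
  imports "HOL-Algebra.Algebra" "Graph_Theory.Digraph_Component"
begin

section \<open>Torsion groups, generating sets and Cayley graphs\<close>

locale torsion_group = group +
  assumes finite_ord: "x \<in> carrier G \<Longrightarrow> \<exists>n::nat. n > 0 \<and> x [^] n = \<one>"

locale finite_generating_set = group +
  fixes S
  assumes gen_finite: "finite S"
    and gen_subset: "S \<subseteq> carrier G"
    and gen_symmetric: "m_inv G ` S = S"
    and gen_one: "\<one> \<notin> S"
    and gen_generate: "generate G S = carrier G"

text \<open>
  A simple undirected graph is a \<^locale>\<open>pair_bidirected_digraph\<close>, i.e. a vertex set
  with a symmetric irreflexive set of ordered pairs as arcs. An undirected edge is the pair of
  opposite arcs between its endpoints.
\<close>

definition cayley_graph :: "('a, 'b) monoid_scheme \<Rightarrow> 'a set \<Rightarrow> 'a pair_pre_digraph" where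
  "cayley_graph G S =
    \<lparr>pverts = carrier G, parcs = {(g, g \<otimes>\<^bsub>G\<^esub> s) | g s. g \<in> carrier G \<and> s \<in> S}\<rparr>"

section \<open>Graph automorphisms and quasi-transitivity\<close>

definition graph_aut :: "'v pair_pre_digraph \<Rightarrow> ('v \<Rightarrow> 'v) set" where
  "graph_aut \<Gamma> = {f \<in> Bij (pverts \<Gamma>).
     \<forall>u\<in>pverts \<Gamma>. \<forall>v\<in>pverts \<Gamma>. (f u, f v) \<in> parcs \<Gamma> \<longleftrightarrow> (u, v) \<in> parcs \<Gamma>}"

definition graph_AutGroup :: "'v pair_pre_digraph \<Rightarrow> ('v \<Rightarrow> 'v) monoid" where
  "graph_AutGroup \<Gamma> = BijGroup (pverts \<Gamma>) \<lparr>carrier := graph_aut \<Gamma>\<rparr>"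

definition acts_quasi_transitively :: "'v pair_pre_digraph \<Rightarrow> ('v \<Rightarrow> 'v) set \<Rightarrow> bool" where
  "acts_quasi_transitively \<Gamma> H \<longleftrightarrow>
     subgroup H (graph_AutGroup \<Gamma>) \<and>
     finite (orbits (graph_AutGroup \<Gamma> \<lparr>carrier := H\<rparr>) (pverts \<Gamma>) (\<lambda>f. f))"

section \<open>Graph height functions\<close>

locale quasi_transitive_graph = pair_bidirected_digraph \<Gamma>
  for \<Gamma> :: "'v pair_pre_digraph" +
  assumes infinite_graph: "infinite (pverts \<Gamma>)"
    and connected_graph: "connected (with_proj \<Gamma>)"
    and locally_finite_graph: "v \<in> pverts \<Gamma> \<Longrightarrow> finite (out_arcs (with_proj \<Gamma>) v)"
    and quasi_transitive: "acts_quasi_transitively \<Gamma> (graph_aut \<Gamma>)"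
begin

definition graph_height_function :: "('v \<Rightarrow> int) \<Rightarrow> ('v \<Rightarrow> 'v) set \<Rightarrow> bool" where
  "graph_height_function h H \<longleftrightarrow>
     acts_quasi_transitively \<Gamma> H \<and>
     (\<forall>u\<in>pverts \<Gamma>. \<forall>v\<in>pverts \<Gamma>. \<forall>g\<in>H. h (g v) - h (g u) = h v - h u) \<and>
     (\<forall>u\<in>pverts \<Gamma>. \<exists>v\<in>pverts \<Gamma>. \<exists>v'\<in>pverts \<Gamma>.
        (u, v) \<in> parcs \<Gamma> \<and> (u, v') \<in> parcs \<Gamma> \<and> h v < h u \<and> h u < h v')"

end

section \<open>Automorphisms form a group\<close>

lemma subgroup_graph_aut: "subgroup (graph_aut \<Gamma>) (BijGroup (pverts \<Gamma>))"
proof (rule group.subgroupI[OF group_BijGroup])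
  show "graph_aut \<Gamma> \<subseteq> carrier (BijGroup (pverts \<Gamma>))"
    by (auto simp: graph_aut_def BijGroup_def)
  have "(\<lambda>x\<in>pverts \<Gamma>. x) \<in> graph_aut \<Gamma>"
    by (simp add: graph_aut_def id_Bij)
  then show "graph_aut \<Gamma> \<noteq> {}" by blast
next
  fix f assume f: "f \<in> graph_aut \<Gamma>"
  then have fB: "f \<in> Bij (pverts \<Gamma>)" by (simp add: graph_aut_def)
  then have img: "f ` pverts \<Gamma> = pverts \<Gamma>" by (simp add: Bij_def bij_betw_def)
  have "(inv_into (pverts \<Gamma>) f u, inv_into (pverts \<Gamma>) f v) \<in> parcs \<Gamma> \<longleftrightarrow> (u, v) \<in> parcs \<Gamma>"
    if "u \<in> pverts \<Gamma>" "v \<in> pverts \<Gamma>" for u v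
    using f that Bij_inv_into_mem[OF fB] f_inv_into_f[of _ f "pverts \<Gamma>"] img
    unfolding graph_aut_def by (smt (verit) mem_Collect_eq)
  then show "inv\<^bsub>BijGroup (pverts \<Gamma>)\<^esub> f \<in> graph_aut \<Gamma>"
    using restrict_inv_into_Bij[OF fB] by (simp add: inv_BijGroup[OF fB] graph_aut_def)
next
  fix f g assume fg: "f \<in> graph_aut \<Gamma>" "g \<in> graph_aut \<Gamma>"
  then have B: "f \<in> Bij (pverts \<Gamma>)" "g \<in> Bij (pverts \<Gamma>)" by (auto simp: graph_aut_def)
  have "g u \<in> pverts \<Gamma>" if "u \<in> pverts \<Gamma>" for u
    using that Bij_imp_funcset[OF B(2)] by auto
  then show "f \<otimes>\<^bsub>BijGroup (pverts \<Gamma>)\<^esub> g \<in> graph_aut \<Gamma>"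
    using fg compose_Bij[OF B] B by (simp add: BijGroup_def graph_aut_def compose_eq)
qed

lemma group_graph_AutGroup: "group (graph_AutGroup \<Gamma>)"
  unfolding graph_AutGroup_def
  by (rule subgroup.subgroup_is_group[OF subgroup_graph_aut group_BijGroup])

section \<open>Infinite Cayley graphs satisfy the standing assumptions on graphs\<close>

context finite_generating_set
begin

lemma cayley_graph_simps [simp]:
  "pverts (cayley_graph G S) = carrier G"
  "(u, v) \<in> parcs (cayley_graph G S) \<longleftrightarrow> u \<in> carrier G \<and> (\<exists>s\<in>S. v = u \<otimes> s)"
  by (auto simp: cayley_graph_def)

lemma gen_inv: "s \<in> S \<Longrightarrow> inv s \<in> S"
  using gen_symmetric by blast

lemma cayley_bidirected: "pair_bidirected_digraph (cayley_graph G S)"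
proof unfold_locales
  show "fst e \<in> pverts (cayley_graph G S)" "snd e \<in> pverts (cayley_graph G S)"
    if "e \<in> parcs (cayley_graph G S)" for e
    using that gen_subset by (cases e; auto)+
  have "\<exists>t\<in>S. u = (u \<otimes> s) \<otimes> t" if "u \<in> carrier G" "s \<in> S" for u s
    using that gen_inv[of s] gen_subset by (intro bexI[of _ "inv s"]) (auto simp: m_assoc subset_iff)
  then show "symmetric (with_proj (cayley_graph G S))"
    using gen_subset by (auto simp: symmetric_def sym_def)
  show "fst e \<noteq> snd e" if "e \<in> parcs (cayley_graph G S)" for e
    using that gen_subset gen_one by (cases e) (auto simp: subset_iff)
qed

lemma cayley_connected: "connected (with_proj (cayley_graph G S))"
proof -
  interpret C: pair_bidirected_digraph "cayley_graph G S" by (rule cayley_bidirected)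
  let ?R = "reachable (with_proj (cayley_graph G S))"
  have reach: "?R u (u \<otimes> x)" if "x \<in> generate G S" "u \<in> carrier G" for x u
    using that
  proof (induction arbitrary: u)
    case one
    then show ?case by (simp add: C.reachable_refl)
  next
    case (incl h)
    then show ?case using gen_subset by (intro C.reachable_adjI) auto
  next
    case (inv h)
    then show ?case using gen_subset gen_inv by (intro C.reachable_adjI) auto
  next
    case (eng x y)
    then have xy: "x \<in> carrier G" "y \<in> carrier G" by (simp_all add: gen_generate)
    then have "?R u (u \<otimes> x)" "?R (u \<otimes> x) ((u \<otimes> x) \<otimes> y)" using eng by auto
    then show ?case using C.reachable_trans xy eng.prems by (metis m_assoc)
  qed
  have "?R u v" if "u \<in> carrier G" "v \<in> carrier G" for u v
  proof -
    have "inv u \<otimes> v \<in> generate G S" using that by (simp add: gen_generate)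
    from reach[OF this that(1)] show ?thesis using that by (simp add: m_assoc[symmetric])
  qed
  then have "strongly_connected (with_proj (cayley_graph G S))"
    by (auto simp: strongly_connected_def)
  moreover have "symmetric (with_proj (cayley_graph G S))" by (rule C.pair_sym_arcs)
  ultimately show ?thesis
    by (auto simp: connected_def strongly_connected_def C.reachable_mk_symmetric_eq)
qed

lemma left_mult_graph_aut:
  assumes "g \<in> carrier G"
  shows "(\<lambda>x\<in>carrier G. g \<otimes> x) \<in> graph_aut (cayley_graph G S)"
proof -
  have "bij_betw (\<lambda>x. g \<otimes> x) (carrier G) (carrier G)"
    by (rule bij_betw_byWitness[where f' = "\<lambda>x. inv g \<otimes> x"])
      (use assms in \<open>auto simp: m_assoc[symmetric]\<close>)
  then have "(\<lambda>x\<in>carrier G. g \<otimes> x) \<in> Bij (carrier G)"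
    by (simp add: Bij_def)
  moreover have "g \<otimes> v = g \<otimes> u \<otimes> s \<longleftrightarrow> v = u \<otimes> s"
    if "u \<in> carrier G" "v \<in> carrier G" "s \<in> S" for u v s
    using that assms gen_subset by (auto simp: m_assoc subset_iff)
  ultimately show ?thesis using assms by (auto simp: graph_aut_def)
qed

lemma cayley_quasi_transitive:
  "acts_quasi_transitively (cayley_graph G S) (graph_aut (cayley_graph G S))"
proof -
  let ?C = "cayley_graph G S"
  let ?A = "graph_AutGroup ?C \<lparr>carrier := graph_aut ?C\<rparr>"
  have "orbit ?A (\<lambda>f. f) x = carrier G" if x: "x \<in> carrier G" for x
  proof
    show "orbit ?A (\<lambda>f. f) x \<subseteq> carrier G"
      using x Bij_imp_funcset by (fastforce simp: orbit_def graph_aut_def)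
    show "carrier G \<subseteq> orbit ?A (\<lambda>f. f) x"
    proof
      fix y assume y: "y \<in> carrier G"
      let ?f = "\<lambda>z\<in>carrier G. (y \<otimes> inv x) \<otimes> z"
      have "?f \<in> graph_aut ?C" using x y by (intro left_mult_graph_aut) simp
      moreover have "?f x = y" using x y by (simp add: m_assoc)
      ultimately have "\<exists>f\<in>graph_aut ?C. y = f x" by (intro bexI[of _ ?f]) simp_all
      then show "y \<in> orbit ?A (\<lambda>f. f) x" by (auto simp: orbit_def)
    qed
  qed
  then have "orbits ?A (pverts ?C) (\<lambda>f. f) \<subseteq> {carrier G}"
    by (auto simp: orbits_def)
  moreover have "subgroup (graph_aut ?C) (graph_AutGroup ?C)"
    using group.subgroup_self[OF group_graph_AutGroup[of ?C]] by (simp add: graph_AutGroup_def)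
  ultimately show ?thesis
    unfolding acts_quasi_transitively_def using finite_subset by blast
qed

lemma cayley_quasi_transitive_graph:
  assumes "infinite (carrier G)"
  shows "quasi_transitive_graph (cayley_graph G S)"
proof (intro quasi_transitive_graph.intro quasi_transitive_graph_axioms.intro)
  fix v
  have "out_arcs (with_proj (cayley_graph G S)) v \<subseteq> (\<lambda>s. (v, v \<otimes> s)) ` S"
    by (auto simp: out_arcs_def)
  then show "finite (out_arcs (with_proj (cayley_graph G S)) v)"
    using gen_finite finite_surj by blast
qed (use assms cayley_bidirected cayley_connected cayley_quasi_transitive in auto)

end

end

theory Submission
  imports Defs
begin

text \<open>
  A graph height function \<open>(h, H)\<close> yields an automorphism \<open>\<gamma>\<close> in \<open>H\<close> that shifts \<open>h\<close> by a
  nonzero constant, so that the forward orbit of the vertex \<open>\<one>\<close> under \<open>\<gamma>\<close> never returns to it.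
  The pointwise stabilizer \<open>U\<close> of a long enough segment of this orbit is tidy above for \<open>\<gamma>\<close> in
  the sense of Willis, whence \<open>(U \<gamma>\<^sup>p U)\<^sup>N \<subseteq> U \<gamma>\<^sup>p\<^sup>N U\<close>, and no element of \<open>U \<gamma>\<^sup>p U\<close> with \<open>p > 0\<close>
  has finite order. On the other hand, for left translations \<open>t\<^sub>n\<close> with \<open>t\<^sub>n \<one> = \<gamma>\<^sup>n \<one>\<close>, local finiteness
  gives \<open>i < j\<close> such that \<open>t\<^sub>i\<inverse> \<gamma>\<^sup>i\<close> and \<open>t\<^sub>j\<inverse> \<gamma>\<^sup>j\<close> agree on the segment. Then \<open>t\<^sub>j t\<^sub>i\<inverse>\<close>, which
  has finite order, is conjugate to an element of \<open>\<gamma>\<^sup>p U\<close> with \<open>p = j - i\<close>.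
\<close>

section \<open>Fixators and orbit segments in a group action\<close>

context group_action
begin

interpretation group G
  using group_hom by (rule group_hom.axioms(1))

definition fixator :: "'c set \<Rightarrow> 'a set" where
  "fixator F = {g \<in> carrier G. \<forall>x\<in>F. \<phi> g x = x}"

text \<open>By orbit-stabilizer, its size is the index of \<open>fixator (insert x F)\<close> in
  \<open>fixator F\<close>; it stands in for an index of compact open subgroups.\<close>

definition fixator_orbit :: "'c set \<Rightarrow> 'c \<Rightarrow> 'c set" where
  "fixator_orbit F x = (\<lambda>g. \<phi> g x) ` fixator F"

text \<open>Integer exponents allow extension backwards as well as forwards along the orbit of
  \<open>x\<close>.\<close>

definition segment :: "'a \<Rightarrow> 'c \<Rightarrow> int \<Rightarrow> int \<Rightarrow> 'c set" where
  "segment \<gamma> x a b = (\<lambda>i. \<phi> (\<gamma> [^] i) x) ` {a..b}"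

lemma fixator_carrier: "g \<in> fixator F \<Longrightarrow> g \<in> carrier G"
  by (simp add: fixator_def)

lemma fixator_antimono: "F \<subseteq> F' \<Longrightarrow> fixator F' \<subseteq> fixator F"
  by (auto simp: fixator_def)

lemma fixator_orbit_antimono: "F \<subseteq> F' \<Longrightarrow> fixator_orbit F' x \<subseteq> fixator_orbit F x"
  unfolding fixator_orbit_def using fixator_antimono by blast

lemma act_closed [simp]: "g \<in> carrier G \<Longrightarrow> x \<in> E \<Longrightarrow> \<phi> g x \<in> E"
  using element_image by blast

lemma act_one [simp]: "x \<in> E \<Longrightarrow> \<phi> \<one> x = x"
  using id_eq_one by (metis restrict_apply')

lemma act_inv_act [simp]:
  assumes "g \<in> carrier G" "x \<in> E"
  shows "\<phi> (inv g) (\<phi> g x) = x" "\<phi> g (\<phi> (inv g) x) = x"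
  using assms by (simp_all flip: composition_rule)

lemma subgroup_fixator:
  assumes "F \<subseteq> E"
  shows "subgroup (fixator F) G"
proof (rule group.subgroupI)
  show "group G" by (rule group_hom.axioms(1)[OF group_hom])
  have "\<one> \<in> fixator F"
    using assms by (auto simp: fixator_def)
  then show "fixator F \<noteq> {}" by blast
  show "inv g \<in> fixator F" if "g \<in> fixator F" for g
  proof -
    have g: "g \<in> carrier G" "\<And>x. x \<in> F \<Longrightarrow> \<phi> g x = x" using that by (auto simp: fixator_def)
    then have "\<phi> (inv g) x = x" if "x \<in> F" for x
      using that assms act_inv_act(1)[of g x] by auto
    then show ?thesis using g by (simp add: fixator_def)
  qed
  show "g \<otimes> k \<in> fixator F" if "g \<in> fixator F" "k \<in> fixator F" for g k
    using that assms by (auto simp: fixator_def composition_rule subset_iff)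
qed (auto simp: fixator_def)

lemma conjugate_mem_fixator:
  assumes "F \<subseteq> E" "k \<in> carrier G" "g \<in> fixator F"
  shows "k \<otimes> g \<otimes> inv k \<in> fixator (\<phi> k ` F)"
proof -
  have "\<phi> (k \<otimes> g \<otimes> inv k) (\<phi> k x) = \<phi> k x" if "x \<in> F" for x
    using that assms
    by (auto simp: composition_rule fixator_def subset_iff)
  then show ?thesis using assms by (auto simp: fixator_def)
qed

lemma segment_subset:
  assumes "\<gamma> \<in> carrier G" "x \<in> E"
  shows "segment \<gamma> x a b \<subseteq> E"
  using assms by (auto simp: segment_def)

lemma segment_mono: "a' \<le> a \<Longrightarrow> b \<le> b' \<Longrightarrow> segment \<gamma> x a b \<subseteq> segment \<gamma> x a' b'"
  by (auto simp: segment_def)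

lemma segment_shift:
  assumes "\<gamma> \<in> carrier G" "x \<in> E"
  shows "\<phi> (\<gamma> [^] c) ` segment \<gamma> x a b = segment \<gamma> x (a + c) (b + c)"
proof -
  have "\<phi> (\<gamma> [^] c) (\<phi> (\<gamma> [^] i) x) = \<phi> (\<gamma> [^] (i + c)) x" for i :: int
    using assms by (simp add: composition_rule[symmetric] int_pow_mult[symmetric] add.commute)
  then have "\<phi> (\<gamma> [^] c) ` segment \<gamma> x a b = (\<lambda>i. \<phi> (\<gamma> [^] i) x) ` ((\<lambda>i. i + c) ` {a..b})"
    by (simp only: segment_def image_image)
  also have "\<dots> = segment \<gamma> x (a + c) (b + c)"
    by (simp only: segment_def image_add_atLeastAtMost')
  finally show ?thesis .
qed

lemma segment_conjugate:
  assumes "\<gamma> \<in> carrier G" "x \<in> E" "g \<in> fixator (segment \<gamma> x a b)"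
  shows "\<gamma> [^] c \<otimes> g \<otimes> \<gamma> [^] (- c :: int) \<in> fixator (segment \<gamma> x (a + c) (b + c))"
  using conjugate_mem_fixator[OF segment_subset[OF assms(1,2)] _ assms(3), of "\<gamma> [^] c"] assms
  by (simp add: segment_shift int_pow_neg)

text \<open>Conjugation by \<open>\<gamma> [^] c\<close> carries one fixator onto the other, so
  \<open>\<gamma> [^] c\<close> itself maps one orbit bijectively onto the other.\<close>

lemma card_fixator_orbit_shift:
  assumes "\<gamma> \<in> carrier G" "x \<in> E"
  shows "card (fixator_orbit (segment \<gamma> x (a + c) (b + c)) (\<phi> (\<gamma> [^] (i + c)) x)) =
    card (fixator_orbit (segment \<gamma> x a b) (\<phi> (\<gamma> [^] i) x))"
    (is "card ?B = card ?A")
proof -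
  have pt: "\<phi> (\<gamma> [^] j) x \<in> E" for j :: int
    using assms by simp
  \<comment> \<open>All indices are arbitrary, since the shift is used both by \<open>c\<close> and
    back by \<open>- c\<close>.\<close>
  have sub: "\<phi> (\<gamma> [^] d) ` fixator_orbit (segment \<gamma> x a b) (\<phi> (\<gamma> [^] i) x) \<subseteq>
      fixator_orbit (segment \<gamma> x (a + d) (b + d)) (\<phi> (\<gamma> [^] (i + d)) x)" for a b i d :: int
  proof (clarsimp simp: fixator_orbit_def)
    fix g assume g: "g \<in> fixator (segment \<gamma> x a b)"
    have c: "g \<in> carrier G" using g by (simp add: fixator_carrier)
    have "\<phi> (\<gamma> [^] d \<otimes> g \<otimes> \<gamma> [^] (- d)) (\<phi> (\<gamma> [^] (i + d)) x) =
        \<phi> (\<gamma> [^] d) (\<phi> g (\<phi> (\<gamma> [^] (- d)) (\<phi> (\<gamma> [^] (i + d)) x)))"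
      using c assms(1) pt by (simp add: composition_rule)
    also have "\<phi> (\<gamma> [^] (- d)) (\<phi> (\<gamma> [^] (i + d)) x) = \<phi> (\<gamma> [^] (- d) \<otimes> \<gamma> [^] (i + d)) x"
      using assms by (simp add: composition_rule)
    also have "\<gamma> [^] (- d) \<otimes> \<gamma> [^] (i + d) = \<gamma> [^] i"
      using assms by (simp add: int_pow_mult[symmetric])
    finally show "\<phi> (\<gamma> [^] d) (\<phi> g (\<phi> (\<gamma> [^] i) x)) \<in>
        (\<lambda>g. \<phi> g (\<phi> (\<gamma> [^] (i + d)) x)) ` fixator (segment \<gamma> x (a + d) (b + d))"
      using segment_conjugate[OF assms g, of d] by (metis image_eqI)
  qed
  have in_E: "fixator_orbit F y \<subseteq> E" if "y \<in> E" for F y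
    using that by (auto simp: fixator_orbit_def fixator_def)
  have comp: "\<phi> (\<gamma> [^] c) (\<phi> (\<gamma> [^] (- c)) y) = y" if "y \<in> E" for y
    using that assms by (simp add: int_pow_neg)
  have "?B \<subseteq> \<phi> (\<gamma> [^] c) ` ?A"
  proof
    fix y assume y: "y \<in> ?B"
    then have "\<phi> (\<gamma> [^] (- c)) y \<in> ?A" using sub[of "- c" "a + c" "b + c" "i + c"] by auto
    moreover have "y = \<phi> (\<gamma> [^] c) (\<phi> (\<gamma> [^] (- c)) y)"
      using comp[of y] subsetD[OF in_E[OF pt] y] by simp
    ultimately show "y \<in> \<phi> (\<gamma> [^] c) ` ?A" by blast
  qed
  then have "?B = \<phi> (\<gamma> [^] c) ` ?A" using sub[of c a b i] by auto
  moreover have "inj_on (\<phi> (\<gamma> [^] c)) ?A"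
    using inj_prop[of "\<gamma> [^] c"] assms in_E[OF pt] by (meson inj_on_subset int_pow_closed)
  ultimately show ?thesis by (simp add: card_image)
qed

section \<open>Stable segments and the tidy factorization\<close>

text \<open>
  Willis' tidying procedure for totally disconnected locally compact groups, in a finitary form.
  The orbit sizes below decrease with \<open>n\<close>, so they stabilize; from then on, fixing further
  points of the axis backwards does not shrink the orbit of the next point.
\<close>
lemma ex_stable_segment:
  assumes "\<gamma> \<in> carrier G" "x \<in> E" and fin: "\<And>y. y \<in> E \<Longrightarrow> finite (fixator_orbit {x} y)"
  obtains m :: nat where "\<And>n k. n \<ge> int m \<Longrightarrow> k \<ge> 0 \<Longrightarrow>
    fixator_orbit (segment \<gamma> x (- k) n) (\<phi> (\<gamma> [^] (n + 1)) x) =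
    fixator_orbit (segment \<gamma> x 0 n) (\<phi> (\<gamma> [^] (n + 1)) x)"
proof -
  define orb where "orb k n = fixator_orbit (segment \<gamma> x (- k) n) (\<phi> (\<gamma> [^] (n + 1)) x)" for k n
  define a where "a n = card (orb 0 (int n))" for n
  have pt: "\<phi> (\<gamma> [^] j) x \<in> E" for j :: int
    using assms by simp
  have "x \<in> segment \<gamma> x (- k) n" if "k \<ge> 0" "n \<ge> 0" for k n
    using that assms(2) unfolding segment_def by (intro image_eqI[of _ _ 0]) auto
  then have fin_orb: "finite (orb k n)" if "k \<ge> 0" "n \<ge> 0" for k n
    using that fixator_orbit_antimono[of "{x}"] finite_subset[OF _ fin[OF pt]]
    unfolding orb_def by (metis empty_subsetI insert_subset)
  \<comment> \<open>Shifting by \<open>k\<close> turns the segment from \<open>- k\<close> to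
    \<open>n\<close> into the one from \<open>0\<close> to \<open>n + k\<close>, so the single
    sequence \<open>a\<close> measures backward extensions too.\<close>
  have card_orb: "card (orb (int k) (int n)) = a (n + k)" for k n
    using card_fixator_orbit_shift[OF assms(1,2), of "- int k" "int k" "int n" "int n + 1"]
    by (simp add: a_def orb_def algebra_simps)
  have sub: "orb k n \<subseteq> orb 0 n" if "k \<ge> 0" for k n
    unfolding orb_def using that by (intro fixator_orbit_antimono segment_mono) auto
  have anti: "a (n + k) \<le> a n" for n k
    using card_mono[OF fin_orb sub[of "int k" "int n"]] card_orb[of k n] by (simp add: a_def)
  \<comment> \<open>A minimizer of \<open>a\<close>; as \<open>a\<close> is antitone, it is constant
    from there on.\<close>
  obtain m where m: "\<And>n. a m \<le> a n"
    using ex_has_least_nat[of "\<lambda>_. True" 0 a] by auto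
  have const: "a n = a m" if "n \<ge> m" for n
    using anti[of m "n - m"] m[of n] that by simp
  show thesis
  proof (rule that)
    fix n k :: int assume nk: "n \<ge> int m" "k \<ge> 0"
    then have "card (orb k n) = card (orb 0 n)"
      using card_orb[of "nat k" "nat n"] card_orb[of 0 "nat n"] const[of "nat n + nat k"]
        const[of "nat n"] by simp
    then show "fixator_orbit (segment \<gamma> x (- k) n) (\<phi> (\<gamma> [^] (n + 1)) x) =
        fixator_orbit (segment \<gamma> x 0 n) (\<phi> (\<gamma> [^] (n + 1)) x)"
      using card_subset_eq[OF fin_orb sub[of k n], of] nk by (simp add: orb_def)
  qed
qed

lemma fixator_segment_Suc:
  assumes "a \<le> b + 1"
  shows "g \<in> fixator (segment \<gamma> x a (b + 1)) \<longleftrightarrow>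
    g \<in> fixator (segment \<gamma> x a b) \<and> \<phi> g (\<phi> (\<gamma> [^] (b + 1)) x) = \<phi> (\<gamma> [^] (b + 1)) x"
proof -
  have "{a..b + 1} = insert (b + 1) {a..b}" using assms by auto
  then show ?thesis by (auto simp: fixator_def segment_def)
qed

text \<open>Finite form of the factorization that defines tidiness above: one factor fixes a long
  backward segment, the other a long forward one. Each step of the induction on \<open>l\<close>
  corrects \<open>v\<close> on the right so that the remainder fixes one more forward point.\<close>

lemma tidy_factorization:
  assumes \<gamma>: "\<gamma> \<in> carrier G" "x \<in> E"
    and stable: "\<And>n. n \<ge> int m \<Longrightarrow>
      fixator_orbit (segment \<gamma> x (- k) n) (\<phi> (\<gamma> [^] (n + 1)) x) =
      fixator_orbit (segment \<gamma> x 0 n) (\<phi> (\<gamma> [^] (n + 1)) x)"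
    and k: "k \<ge> 0" and u: "u \<in> fixator (segment \<gamma> x 0 (int m))"
  shows "\<exists>v \<in> fixator (segment \<gamma> x (- k) (int m)).
    inv v \<otimes> u \<in> fixator (segment \<gamma> x 0 (int m + int l))"
proof (induction l)
  case 0
  have "\<one> \<in> fixator (segment \<gamma> x (- k) (int m))"
    by (rule subgroup.one_closed[OF subgroup_fixator[OF segment_subset[OF \<gamma>]]])
  then show ?case using u fixator_carrier by (intro bexI[of _ \<one>]) auto
next
  case (Suc l)
  let ?n = "int m + int l" and ?F = "\<lambda>a b. fixator (segment \<gamma> x a b)"
  let ?p = "\<phi> (\<gamma> [^] (?n + 1)) x"
  have p: "?p \<in> E" using \<gamma> by simp
  have sg: "subgroup (?F a b) G" for a b
    by (rule subgroup_fixator[OF segment_subset[OF \<gamma>]])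
  from Suc obtain v where v: "v \<in> ?F (- k) (int m)" "inv v \<otimes> u \<in> ?F 0 ?n" by blast
  \<comment> \<open>The remainder fixes the segment from \<open>0\<close> to \<open>?n\<close>. By
    stability, its effect on the next point \<open>?p\<close> is matched by some \<open>w\<close>
    that also fixes the points back to \<open>- k\<close>.\<close>
  then have "\<phi> (inv v \<otimes> u) ?p \<in> fixator_orbit (segment \<gamma> x (- k) ?n) ?p"
    using stable[of ?n] by (simp add: fixator_orbit_def)
  then obtain w where w: "w \<in> ?F (- k) ?n" "\<phi> w ?p = \<phi> (inv v \<otimes> u) ?p"
    by (auto simp: fixator_orbit_def)
  have c: "u \<in> carrier G" "v \<in> carrier G" "w \<in> carrier G"
    using u v w by (auto dest: fixator_carrier)
  \<comment> \<open>These two facts let \<open>w\<close> be absorbed into \<open>v\<close> and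
    removed from the remainder without losing what either already fixes.\<close>
  have "w \<in> ?F (- k) (int m)" "w \<in> ?F 0 ?n"
    using w(1) k fixator_antimono[OF segment_mono[of "- k" "- k" "int m" ?n \<gamma> x]]
      fixator_antimono[OF segment_mono[of "- k" 0 ?n ?n \<gamma> x]] by auto
  then have vw: "v \<otimes> w \<in> ?F (- k) (int m)" "inv w \<otimes> (inv v \<otimes> u) \<in> ?F 0 ?n"
    using v sg by (auto intro: subgroup.m_closed subgroup.m_inv_closed)
  moreover have "\<phi> (inv w \<otimes> (inv v \<otimes> u)) ?p = ?p"
    using c p w(2) composition_rule[of ?p "inv w" "inv v \<otimes> u"]
    by (metis act_inv_act(1) inv_closed m_closed)
  moreover have "inv (v \<otimes> w) \<otimes> u = inv w \<otimes> (inv v \<otimes> u)"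
    using c by (simp add: inv_mult_group m_assoc)
  ultimately have "inv (v \<otimes> w) \<otimes> u \<in> ?F 0 (?n + 1)"
    by (subst fixator_segment_Suc) auto
  then show ?case using vw(1) by (intro bexI[of _ "v \<otimes> w"]) (auto simp: algebra_simps)
qed

text \<open>
  An element of \<open>U\<close> between \<open>\<gamma> [^] a\<close> and \<open>\<gamma> [^] b\<close> is split as \<open>v \<otimes> w\<close>, where conjugation by
  \<open>\<gamma> [^] a\<close> moves \<open>v\<close> to the left into \<open>U\<close> and conjugation by the inverse of \<open>\<gamma> [^] b\<close> moves \<open>w\<close>
  to the right into \<open>U\<close>.
\<close>
lemma double_coset_mult:
  assumes \<gamma>: "\<gamma> \<in> carrier G" "x \<in> E"
    and stable: "\<And>n k. n \<ge> int m \<Longrightarrow> k \<ge> 0 \<Longrightarrow>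
      fixator_orbit (segment \<gamma> x (- k) n) (\<phi> (\<gamma> [^] (n + 1)) x) =
      fixator_orbit (segment \<gamma> x 0 n) (\<phi> (\<gamma> [^] (n + 1)) x)"
    and U: "U = fixator (segment \<gamma> x 0 (int m))"
    and y: "y \<in> U <#> (\<gamma> [^] a <# U)" and z: "z \<in> U <#> (\<gamma> [^] b <# U)"
  shows "y \<otimes> z \<in> U <#> (\<gamma> [^] (a + b :: nat) <# U)"
proof -
  have sg: "subgroup U G" unfolding U by (rule subgroup_fixator[OF segment_subset[OF \<gamma>]])
  have Uc: "\<And>u. u \<in> U \<Longrightarrow> u \<in> carrier G" using U fixator_carrier by blast
  obtain u1 u2 where y': "u1 \<in> U" "u2 \<in> U" "y = u1 \<otimes> (\<gamma> [^] a \<otimes> u2)"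
    using y by (auto simp: set_mult_def l_coset_def)
  obtain u3 u4 where z': "u3 \<in> U" "u4 \<in> U" "z = u3 \<otimes> (\<gamma> [^] b \<otimes> u4)"
    using z by (auto simp: set_mult_def l_coset_def)
  have "u2 \<otimes> u3 \<in> U" using y' z' sg by (auto intro: subgroup.m_closed)
  \<comment> \<open>The lengths \<open>int a\<close> and \<open>b\<close> are the amounts by which
    the two conjugations below shift the segments; each shifted segment still contains the one
    defining \<open>U\<close>.\<close>
  then obtain v where v: "v \<in> fixator (segment \<gamma> x (- int a) (int m))"
    "inv v \<otimes> (u2 \<otimes> u3) \<in> fixator (segment \<gamma> x 0 (int m + int b))"
    using tidy_factorization[OF \<gamma> stable, where k = "int a" and l = b] U by auto
  define w where "w = inv v \<otimes> (u2 \<otimes> u3)"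
  have c: "v \<in> carrier G" "u1 \<in> carrier G" "u2 \<in> carrier G" "u3 \<in> carrier G" "u4 \<in> carrier G" "w \<in> carrier G"
    using v y' z' Uc fixator_carrier by (auto simp: w_def)
  have "\<gamma> [^] int a \<otimes> v \<otimes> \<gamma> [^] (- int a) \<in> U"
    using segment_conjugate[OF \<gamma> v(1), of "int a"] fixator_antimono[OF segment_mono]
    unfolding U by (metis (no_types, lifting) add.left_inverse le_add_same_cancel1 of_nat_0_le_iff order_refl subsetD)
  then have v': "\<gamma> [^] a \<otimes> v \<otimes> inv (\<gamma> [^] a) \<in> U" (is "?v \<in> U")
    using \<gamma> by (simp add: int_pow_neg int_pow_int)
  have "\<gamma> [^] (- int b) \<otimes> w \<otimes> \<gamma> [^] (- (- int b)) \<in>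
      fixator (segment \<gamma> x (0 + - int b) (int m + int b + - int b))"
    using segment_conjugate[OF \<gamma> v(2), of "- int b"] by (simp add: w_def)
  moreover have "\<dots> \<subseteq> U"
    unfolding U by (intro fixator_antimono segment_mono) auto
  ultimately have w': "inv (\<gamma> [^] b) \<otimes> w \<otimes> \<gamma> [^] b \<in> U" (is "?w \<in> U")
    using \<gamma> by (auto simp: int_pow_neg int_pow_int)
  have w_eq: "u2 \<otimes> u3 = v \<otimes> w" using c by (simp add: w_def inv_solve_left m_assoc[symmetric])
  have "y \<otimes> z = u1 \<otimes> (\<gamma> [^] a \<otimes> (u2 \<otimes> u3) \<otimes> (\<gamma> [^] b \<otimes> u4))"
    using c \<gamma> y' z' by (simp add: m_assoc)
  also have "\<dots> = (u1 \<otimes> ?v) \<otimes> (\<gamma> [^] (a + b) \<otimes> (?w \<otimes> u4))"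
  proof -
    have "inv (\<gamma> [^] a) \<otimes> (\<gamma> [^] a \<otimes> t) = t" "\<gamma> [^] b \<otimes> (inv (\<gamma> [^] b) \<otimes> t) = t" if "t \<in> carrier G" for t
      using that \<gamma> by (simp_all add: m_assoc[symmetric])
    then show ?thesis unfolding w_eq using c \<gamma> by (simp add: nat_pow_mult[symmetric] m_assoc)
  qed
  finally have "y \<otimes> z = (u1 \<otimes> ?v) \<otimes> (\<gamma> [^] (a + b) \<otimes> (?w \<otimes> u4))" .
  moreover have "u1 \<otimes> ?v \<in> U" "?w \<otimes> u4 \<in> U"
    using v' w' y' z' sg by (auto intro: subgroup.m_closed)
  ultimately show ?thesis unfolding set_mult_def l_coset_def by blast
qed

text \<open>The exponents of \<open>\<gamma>\<close> add up without cancellation, so a trivial power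
  of \<open>y\<close> forces a power of \<open>\<gamma>\<close> into \<open>U\<close>.\<close>

lemma double_coset_power:
  assumes \<gamma>: "\<gamma> \<in> carrier G" "x \<in> E"
    and stable: "\<And>n k. n \<ge> int m \<Longrightarrow> k \<ge> 0 \<Longrightarrow>
      fixator_orbit (segment \<gamma> x (- k) n) (\<phi> (\<gamma> [^] (n + 1)) x) =
      fixator_orbit (segment \<gamma> x 0 n) (\<phi> (\<gamma> [^] (n + 1)) x)"
    and U: "U = fixator (segment \<gamma> x 0 (int m))"
    and y: "y \<in> U <#> (\<gamma> [^] (p::nat) <# U)"
  shows "y [^] n \<in> U <#> (\<gamma> [^] (p * n :: nat) <# U)"
proof (induction n)
  case 0
  have "\<one> \<in> U" unfolding U by (rule subgroup.one_closed[OF subgroup_fixator[OF segment_subset[OF \<gamma>]]])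
  then show ?case by (force simp: set_mult_def l_coset_def)
next
  case (Suc n)
  show ?case using double_coset_mult[OF \<gamma> stable U Suc y] by (simp add: add.commute)
qed

text \<open>The finite orbits of the stabilizer of \<open>x\<close> are the abstract form of local
  finiteness; \<open>T\<close> plays the role of the left translations.\<close>

theorem torsion_transitive_imp_elliptic:
  assumes T: "subgroup T G" and trans: "\<And>y. y \<in> E \<Longrightarrow> \<exists>t\<in>T. \<phi> t x = y"
    and torsion: "\<And>t. t \<in> T \<Longrightarrow> \<exists>n::nat. n > 0 \<and> t [^] n = \<one>"
    and \<gamma>: "\<gamma> \<in> carrier G" "x \<in> E"
    and fin: "\<And>y. y \<in> E \<Longrightarrow> finite (fixator_orbit {x} y)"
  shows "\<exists>n::nat. n > 0 \<and> \<phi> (\<gamma> [^] n) x = x"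
proof -
  obtain m :: nat where stable: "\<And>n k. n \<ge> int m \<Longrightarrow> k \<ge> 0 \<Longrightarrow>
      fixator_orbit (segment \<gamma> x (- k) n) (\<phi> (\<gamma> [^] (n + 1)) x) =
      fixator_orbit (segment \<gamma> x 0 n) (\<phi> (\<gamma> [^] (n + 1)) x)"
    using ex_stable_segment[OF \<gamma> fin] by blast
  define F where "F = segment \<gamma> x 0 (int m)"
  define U where "U = fixator F"
  have F: "finite F" "F \<subseteq> E" using segment_subset[OF \<gamma>] by (simp_all add: F_def segment_def)
  have xF: "x \<in> F"
    using \<gamma>(2) unfolding F_def segment_def by (intro image_eqI[of _ _ 0]) auto
  have sg: "subgroup U G" unfolding U_def by (rule subgroup_fixator[OF F(2)])
  have "\<exists>t\<in>T. \<phi> t x = \<phi> (\<gamma> [^] n) x" for n :: nat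
    using \<gamma> by (intro trans) simp
  then obtain t where t: "\<And>n. t n \<in> T" "\<And>n::nat. \<phi> (t n) x = \<phi> (\<gamma> [^] n) x" by metis
  have tc: "t n \<in> carrier G" for n using t(1) T by (simp add: subgroup.mem_carrier)
  define k where "k n = inv (t n) \<otimes> \<gamma> [^] n" for n :: nat
  have kc: "k n \<in> carrier G" for n using tc \<gamma> by (simp add: k_def)
  have "k n \<in> fixator {x}" for n
    using kc[of n] tc[of n] \<gamma> t(2)[of n, symmetric]
    by (simp add: fixator_def k_def composition_rule)
  \<comment> \<open>Pigeonhole: each \<open>k n\<close> fixes \<open>x\<close>, so it moves every
    point of the finite set \<open>F\<close> within a finite orbit, and only finitely many
    restrictions to \<open>F\<close> occur.\<close>
  then have "(\<lambda>n. restrict (\<phi> (k n)) F) ` UNIV \<subseteq> (\<Pi>\<^sub>E y\<in>F. fixator_orbit {x} y)"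
    by (auto simp: fixator_orbit_def)
  moreover have "finite (\<Pi>\<^sub>E y\<in>F. fixator_orbit {x} y)"
    using F fin by (intro finite_PiE) auto
  ultimately have "\<not> inj (\<lambda>n. restrict (\<phi> (k n)) F)"
    using finite_subset finite_imageD infinite_UNIV_nat by metis
  then obtain i j where "i \<noteq> j" "restrict (\<phi> (k i)) F = restrict (\<phi> (k j)) F"
    by (auto simp: inj_def)
  then obtain i j where ij: "i < j" and eq: "restrict (\<phi> (k i)) F = restrict (\<phi> (k j)) F"
    by (metis linorder_neqE_nat)
  define u where "u = inv (k j) \<otimes> k i"
  have "\<phi> u y = y" if "y \<in> F" for y
  proof -
    have "\<phi> (k i) y = \<phi> (k j) y" using fun_cong[OF eq, of y] that by simp
    then show ?thesis using that F kc by (auto simp: u_def composition_rule subset_iff)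
  qed
  then have u: "u \<in> U" using kc by (simp add: U_def u_def fixator_def)
  define p where "p = j - i"
  define s where "s = t j \<otimes> inv (t i)"
  have "s \<in> T" using t T by (simp add: s_def subgroup.m_closed subgroup.m_inv_closed)
  then obtain N :: nat where N: "N > 0" "s [^] N = \<one>" using torsion by blast
  have sc: "s \<in> carrier G" using tc by (simp add: s_def)
  define y where "y = \<gamma> [^] p \<otimes> u"
  have uc: "u \<in> carrier G" using kc by (simp add: u_def)
  have yc: "y \<in> carrier G" using uc \<gamma> by (simp add: y_def)
  have "\<gamma> [^] i \<otimes> y = s \<otimes> \<gamma> [^] i"
  proof -
    have "\<gamma> [^] i \<otimes> y = \<gamma> [^] j \<otimes> u"
      using ij \<gamma> uc by (simp add: y_def p_def m_assoc[symmetric] nat_pow_mult)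
    also have "\<dots> = \<gamma> [^] j \<otimes> (inv (\<gamma> [^] j) \<otimes> t j \<otimes> (inv (t i) \<otimes> \<gamma> [^] i))"
      using tc \<gamma> by (simp add: u_def k_def inv_mult_group)
    also have "\<dots> = s \<otimes> \<gamma> [^] i"
      using tc \<gamma> by (simp add: s_def m_assoc[symmetric])
    finally show ?thesis .
  qed
  \<comment> \<open>Since \<open>u\<close> equals \<open>inv (k j) \<otimes> k i\<close>, the
    element \<open>y\<close> is conjugate to \<open>s\<close> by \<open>\<gamma> [^] i\<close> and
    inherits its finite order.\<close>
  then have conj: "\<gamma> [^] i \<otimes> y [^] n = s [^] n \<otimes> \<gamma> [^] i" for n :: nat
  proof (induction n)
    case (Suc n)
    have "\<gamma> [^] i \<otimes> y [^] Suc n = (\<gamma> [^] i \<otimes> y [^] n) \<otimes> y"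
      using yc \<gamma> by (simp add: m_assoc)
    also have "\<dots> = s [^] n \<otimes> (\<gamma> [^] i \<otimes> y)" using Suc yc sc \<gamma> by (simp add: m_assoc)
    also have "\<dots> = s [^] Suc n \<otimes> \<gamma> [^] i" using Suc.prems sc \<gamma> by (simp add: m_assoc)
    finally show ?case .
  qed (use \<gamma> in simp)
  have "y [^] N = \<one>"
    using conj[of N] N yc \<gamma> by (simp add: l_cancel_one)
  moreover have "y \<in> U <#> (\<gamma> [^] p <# U)"
  proof -
    have "y = \<one> \<otimes> (\<gamma> [^] p \<otimes> u)" using yc by (simp add: y_def)
    then show ?thesis using u subgroup.one_closed[OF sg] unfolding set_mult_def l_coset_def by blast
  qed
  ultimately have "\<one> \<in> U <#> (\<gamma> [^] (p * N) <# U)"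
    using double_coset_power[OF \<gamma> stable U_def[unfolded F_def], where p = p and n = N and y = y] by simp
  then obtain v w where vw: "v \<in> U" "w \<in> U" "\<one> = v \<otimes> (\<gamma> [^] (p * N) \<otimes> w)"
    by (auto simp: set_mult_def l_coset_def)
  have c: "v \<in> carrier G" "w \<in> carrier G" using vw sg by (auto simp: subgroup.mem_carrier)
  \<comment> \<open>Solving the double coset equation for the power of \<open>\<gamma>\<close> puts
    it in \<open>U\<close>, which fixes \<open>x\<close> because \<open>x\<close> is a point of
    \<open>F\<close>.\<close>
  have "\<gamma> [^] (p * N) = inv v \<otimes> (v \<otimes> (\<gamma> [^] (p * N) \<otimes> w)) \<otimes> inv w"
    using c \<gamma> by (simp add: m_assoc[symmetric]) (simp add: m_assoc)
  then have "\<gamma> [^] (p * N) = inv v \<otimes> inv w" using c by (simp flip: vw(3))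
  then have "\<gamma> [^] (p * N) \<in> U" using vw sg by (simp add: subgroup.m_closed subgroup.m_inv_closed)
  then have "\<phi> (\<gamma> [^] (p * N)) x = x" using xF by (simp add: U_def fixator_def)
  moreover have "p * N > 0" using ij N by (simp add: p_def)
  ultimately show ?thesis by blast
qed

end

section \<open>Automorphisms of Cayley graphs of torsion groups\<close>

lemma group_action_graph_AutGroup:
  "group_action (graph_AutGroup \<Gamma>) (pverts \<Gamma>) (\<lambda>f. f)"
proof (intro group_action.intro group_hom.intro group_hom_axioms.intro)
  show "group (graph_AutGroup \<Gamma>)" "group (BijGroup (pverts \<Gamma>))"
    by (rule group_graph_AutGroup, rule group_BijGroup)
  show "(\<lambda>f. f) \<in> hom (graph_AutGroup \<Gamma>) (BijGroup (pverts \<Gamma>))"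
    by (auto simp: hom_def graph_AutGroup_def graph_aut_def BijGroup_def)
qed

context finite_generating_set
begin

lemma left_mult_hom:
  "(\<lambda>g. \<lambda>x\<in>carrier G. g \<otimes> x) \<in> hom G (graph_AutGroup (cayley_graph G S))"
proof (rule homI)
  fix g k assume gk: "g \<in> carrier G" "k \<in> carrier G"
  then have "(\<lambda>x\<in>carrier G. g \<otimes> x) \<in> Bij (carrier G)" "(\<lambda>x\<in>carrier G. k \<otimes> x) \<in> Bij (carrier G)"
    using left_mult_graph_aut by (auto simp: graph_aut_def)
  then show "(\<lambda>x\<in>carrier G. g \<otimes> k \<otimes> x) = (\<lambda>x\<in>carrier G. g \<otimes> x)
      \<otimes>\<^bsub>graph_AutGroup (cayley_graph G S)\<^esub> (\<lambda>x\<in>carrier G. k \<otimes> x)"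
    using gk by (auto simp: graph_AutGroup_def BijGroup_def compose_def m_assoc)
qed (use left_mult_graph_aut in \<open>simp add: graph_AutGroup_def\<close>)

text \<open>An automorphism sends the neighbour \<open>u \<otimes> s\<close> of \<open>u\<close> to
  a neighbour of the image of \<open>u\<close>, so each edge multiplies the number of possible
  images by at most the size of \<open>S\<close>. Only \<open>\<one>\<close> is possible at the
  start.\<close>

lemma finite_graph_aut_stabilizer_orbit:
  assumes "y \<in> carrier G"
  shows "finite {f y | f. f \<in> graph_aut (cayley_graph G S) \<and> f \<one> = \<one>}" (is "finite (?O y)")
proof -
  have step: "finite (?O (u \<otimes> s))" if "finite (?O u)" "u \<in> carrier G" "s \<in> S" for u s
  proof -
    have us: "u \<otimes> s \<in> carrier G" using that gen_subset by auto
    have "?O (u \<otimes> s) \<subseteq> (\<lambda>(a, t). a \<otimes> t) ` (?O u \<times> S)"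
    proof clarify
      fix f assume f: "f \<in> graph_aut (cayley_graph G S)" "f \<one> = \<one>"
      have "(u, u \<otimes> s) \<in> parcs (cayley_graph G S)" using that by auto
      then have "(f u, f (u \<otimes> s)) \<in> parcs (cayley_graph G S)"
        using f(1) that us by (simp add: graph_aut_def del: cayley_graph_simps(2))
      then obtain t where "t \<in> S" "f (u \<otimes> s) = f u \<otimes> t" by auto
      then show "f (u \<otimes> s) \<in> (\<lambda>(a, t). a \<otimes> t) ` (?O u \<times> S)"
        using f by (intro image_eqI[of _ _ "(f u, t)"]) auto
    qed
    then show ?thesis
      using that(1) gen_finite by (meson finite_SigmaI finite_imageI finite_subset)
  qed
  \<comment> \<open>The starting vertex \<open>u\<close> is arbitrary so that the two factors in
    case \<open>eng\<close> can be traversed in succession.\<close>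
  have "finite (?O (u \<otimes> x))" if "x \<in> generate G S" "u \<in> carrier G" "finite (?O u)" for x u
    using that
  proof (induction arbitrary: u)
    case (eng x y)
    then have xy: "x \<in> carrier G" "y \<in> carrier G" by (simp_all add: gen_generate)
    then have "finite (?O ((u \<otimes> x) \<otimes> y))" using eng by auto
    then show ?case using xy eng.prems by (simp add: m_assoc)
  qed (use step gen_inv in auto)
  moreover have "finite (?O \<one>)" by (rule finite_subset[of _ "{\<one>}"]) auto
  ultimately have "finite (?O (\<one> \<otimes> y))" using assms gen_generate by blast
  then show ?thesis using assms by simp
qed

theorem torsion_imp_graph_aut_elliptic:
  assumes "torsion_group G" and \<gamma>: "\<gamma> \<in> graph_aut (cayley_graph G S)"
  shows "\<exists>n::nat. n > 0 \<and> (\<gamma> [^]\<^bsub>graph_AutGroup (cayley_graph G S)\<^esub> n) \<one> = \<one>"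
proof -
  let ?A = "graph_AutGroup (cayley_graph G S)" and ?L = "\<lambda>g. \<lambda>x\<in>carrier G. g \<otimes> x"
  interpret A: group_action ?A "carrier G" "\<lambda>f. f"
    using group_action_graph_AutGroup[of "cayley_graph G S"] by simp
  interpret L: group_hom G ?A ?L
    by (intro group_hom.intro group_hom_axioms.intro left_mult_hom group_graph_AutGroup is_group)
  show ?thesis
  proof (rule A.torsion_transitive_imp_elliptic)
    \<comment> \<open>The left translations serve as \<open>T\<close>: they are transitive, and
      torsion passes to them through the homomorphism \<open>?L\<close>.\<close>
    show "subgroup (?L ` carrier G) ?A" by (rule L.img_is_subgroup)
    show "\<exists>t\<in>?L ` carrier G. t \<one> = y" if "y \<in> carrier G" for y
      using that by force
    show "\<exists>n::nat. n > 0 \<and> t [^]\<^bsub>?A\<^esub> n = \<one>\<^bsub>?A\<^esub>" if t: "t \<in> ?L ` carrier G" for t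
    proof -
      obtain g where g: "g \<in> carrier G" "t = ?L g" using t by auto
      obtain n :: nat where "n > 0" "g [^] n = \<one>"
        using torsion_group.finite_ord[OF assms(1) g(1)] by blast
      then show ?thesis using L.hom_nat_pow[OF g(1), of n] g by (metis L.hom_one)
    qed
    show "finite (A.fixator_orbit {\<one>} y)" if "y \<in> carrier G" for y
    proof -
      have "A.fixator_orbit {\<one>} y = {f y | f. f \<in> graph_aut (cayley_graph G S) \<and> f \<one> = \<one>}"
        unfolding A.fixator_orbit_def A.fixator_def by (auto simp: graph_AutGroup_def)
      then show ?thesis using finite_graph_aut_stabilizer_orbit[OF that] by simp
    qed
  qed (use \<gamma> in \<open>simp_all add: graph_AutGroup_def\<close>)
qed

end

section \<open>Height functions and translations\<close>

text \<open>If all of \<open>H\<close> preserved \<open>h\<close>, then \<open>h\<close> would take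
  finitely many values, one per orbit, and a vertex of maximal height would have no higher
  neighbour. Invariance of differences makes the shift the same at every vertex.\<close>

lemma (in quasi_transitive_graph) height_function_translation:
  assumes "graph_height_function h H"
  obtains \<gamma> d where "\<gamma> \<in> graph_aut \<Gamma>" "d \<noteq> 0" "\<And>v. v \<in> pverts \<Gamma> \<Longrightarrow> h (\<gamma> v) = h v + d"
proof -
  let ?A = "graph_AutGroup \<Gamma>" and ?V = "pverts \<Gamma>"
  let ?orb = "orbit (?A \<lparr>carrier := H\<rparr>) (\<lambda>f. f)"
    and ?orbs = "orbits (?A \<lparr>carrier := H\<rparr>) ?V (\<lambda>f. f)"
    and ?rep = "\<lambda>B. h (SOME w. w \<in> B)"
  have H: "subgroup H ?A" and fin: "finite ?orbs"
    and inv: "\<And>u v g. u \<in> ?V \<Longrightarrow> v \<in> ?V \<Longrightarrow> g \<in> H \<Longrightarrow> h (g v) - h (g u) = h v - h u"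
    and up: "\<And>u. u \<in> ?V \<Longrightarrow> \<exists>v\<in>?V. h u < h v"
    using assms unfolding graph_height_function_def acts_quasi_transitively_def by blast+
  have "\<exists>\<gamma>\<in>H. \<exists>v\<in>?V. h (\<gamma> v) \<noteq> h v"
  proof (rule ccontr)
    assume "\<not> ?thesis"
    then have eq: "h (g v) = h v" if "g \<in> H" "v \<in> ?V" for g v using that by blast
    \<comment> \<open>A chosen representative depends only on the orbit, so \<open>h\<close> factors
      through the finite set of orbits.\<close>
    have "h v = h (SOME w. w \<in> ?orb v)" if v: "v \<in> ?V" for v
    proof -
      have "(\<lambda>x\<in>?V. x) \<in> H"
        using subgroup.one_closed[OF H] by (simp add: graph_AutGroup_def BijGroup_def)
      then have "v \<in> ?orb v" using v unfolding orbit_def by (auto intro!: exI[of _ "\<lambda>x\<in>?V. x"])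
      then have "(SOME w. w \<in> ?orb v) \<in> ?orb v" by (rule someI)
      then show ?thesis using eq v by (auto simp: orbit_def)
    qed
    then have "h ` ?V \<subseteq> ?rep ` ?orbs"
      unfolding orbits_def by blast
    then have fin_h: "finite (h ` ?V)" using fin finite_surj by blast
    have ne: "h ` ?V \<noteq> {}" using infinite_graph by auto
    obtain u where "u \<in> ?V" "h u = Max (h ` ?V)" using Max_in[OF fin_h ne] by auto
    then show False using up[of u] Max_ge[OF fin_h] by fastforce
  qed
  then obtain \<gamma> v where \<gamma>: "\<gamma> \<in> H" and v: "v \<in> ?V" "h (\<gamma> v) \<noteq> h v" by blast
  show thesis
  proof (rule that)
    show "\<gamma> \<in> graph_aut \<Gamma>" using subgroup.mem_carrier[OF H \<gamma>] by (simp add: graph_AutGroup_def)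
    show "h (\<gamma> v) - h v \<noteq> 0" using v by simp
    show "h (\<gamma> w) = h w + (h (\<gamma> v) - h v)" if "w \<in> ?V" for w
      using inv[OF v(1) that \<gamma>] by simp
  qed
qed

theorem theorem3:
  fixes G :: "('a, 'b) monoid_scheme" and S :: "'a set"
  assumes "torsion_group G"
    and "infinite (carrier G)"
    and "finite_generating_set G S"
  shows "\<not> (\<exists>h H. quasi_transitive_graph.graph_height_function (cayley_graph G S) h H)"
proof (intro notI, elim exE)
  fix h H
  assume h: "quasi_transitive_graph.graph_height_function (cayley_graph G S) h H"
  interpret finite_generating_set G S by fact
  let ?A = "graph_AutGroup (cayley_graph G S)"
  interpret A: group_action ?A "carrier G" "\<lambda>f. f"
    using group_action_graph_AutGroup[of "cayley_graph G S"] by simp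
  interpret AG: group ?A by (rule group_graph_AutGroup)
  obtain \<gamma> d where \<gamma>: "\<gamma> \<in> graph_aut (cayley_graph G S)" "d \<noteq> 0"
    "\<And>v. v \<in> carrier G \<Longrightarrow> h (\<gamma> v) = h v + d"
    using quasi_transitive_graph.height_function_translation[OF
        cayley_quasi_transitive_graph[OF assms(2)] h] by auto
  have c: "\<gamma> \<in> carrier ?A" using \<gamma>(1) by (simp add: graph_AutGroup_def)
  \<comment> \<open>The vertex is generalized because the successor power applies
    \<open>\<gamma>\<close> first, so the induction hypothesis is needed at
    \<open>\<gamma> v\<close>.\<close>
  have "h ((\<gamma> [^]\<^bsub>?A\<^esub> n) v) = h v + int n * d" if "v \<in> carrier G" for n :: nat and v
    using that
  proof (induction n arbitrary: v)
    case 0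
    then show ?case by (simp)
  next
    case (Suc n)
    have "\<gamma> v \<in> carrier G" using A.element_image[OF c Suc.prems] by simp
    then show ?case
      using Suc c \<gamma>(3) by (simp add: A.composition_rule algebra_simps)
  qed
  then have "(\<gamma> [^]\<^bsub>?A\<^esub> n) \<one>\<^bsub>G\<^esub> \<noteq> \<one>\<^bsub>G\<^esub>" if "n > 0" for n :: nat
    using that \<gamma>(2) by (metis add_cancel_right_right mult_eq_0_iff of_nat_eq_0_iff one_closed not_gr_zero)
  then show False using torsion_imp_graph_aut_elliptic[OF assms(1) \<gamma>(1)] by blast
qed

end
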